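(* Let $\mathcal{H}$ be a Hilbert space (finite-dimensional or infinite-dimensional). Then for every integer $n\ge 2$ there exists a Lipschitz retraction $r_n\colon \mathcal{H}(n)\to \mathcal{H}(n-1)$, where $\mathcal{H}(k)$ denotes the space of nonempty subsets of $\mathcal{H}$ of cardinality at most $k$ with the Hausdorff metric.
   Context: For a metric space $X$ and an integer $n\ge 1$, $X(n)$ denotes the set of all nonempty subsets of $X$ with cardinality at most $n$, equipped with the Hausdorff metric $d_H(A,B)=\max\{\max_{a\in A}\min_{b\in B} d(a,b),\ \max_{b\in B}\min_{a\in A} d(a,b)\}$. One has $X(n-1)\subset X(n)$ as an isometric (inclusion) embedding. A Lipschitz retraction $r\colon X(n)\to X(n-1)$ is a map that is Lipschitz with respect to the Hausdorff metrics and satisfies $r(A)=A$ for every $A\in X(n-1)$. *)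

theory Defs
  imports "HOL-Analysis.Analysis"
begin

text \<open>The locale \<^locale>\<open>Metric_space\<close> requires nonnegativity and symmetry of the distance
  function on the whole type, whereas \<^const>\<open>Max\<close> and \<^const>\<open>Min\<close> are only meaningful for
  nonempty finite sets; hence the default value outside the domain of interest.\<close>

definition hausdorff_dist :: "'a::metric_space set \<Rightarrow> 'a set \<Rightarrow> real" where
  "hausdorff_dist A B =
     (if finite A \<and> A \<noteq> {} \<and> finite B \<and> B \<noteq> {}
      then max (MAX a\<in>A. MIN b\<in>B. dist a b) (MAX b\<in>B. MIN a\<in>A. dist a b)
      else 0)"

definition finite_subsets :: "nat \<Rightarrow> 'a set set" where
  "finite_subsets n = {A. finite A \<and> A \<noteq> {} \<and> card A \<le> n}"

definition finite_subset_space :: "nat \<Rightarrow> 'a::metric_space set metric" where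
  "finite_subset_space n = metric (finite_subsets n, hausdorff_dist)"

lemma hausdorff_dist_le_iff:
  fixes A B :: "'a::metric_space set"
  assumes "finite A" "A \<noteq> {}" "finite B" "B \<noteq> {}"
  shows "hausdorff_dist A B \<le> e \<longleftrightarrow>
           (\<forall>a\<in>A. \<exists>b\<in>B. dist a b \<le> e) \<and> (\<forall>b\<in>B. \<exists>a\<in>A. dist a b \<le> e)"
  using assms by (simp add: hausdorff_dist_def Min_le_iff)

lemma hausdorff_dist_nonneg:
  fixes A B :: "'a::metric_space set"
  shows "0 \<le> hausdorff_dist A B"
proof (cases "finite A \<and> A \<noteq> {} \<and> finite B \<and> B \<noteq> {}")
  case True
  then have "\<forall>a\<in>A. \<exists>b\<in>B. dist a b \<le> hausdorff_dist A B"
    using hausdorff_dist_le_iff[of A B "hausdorff_dist A B"] by simp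
  with True obtain a b :: 'a where "dist a b \<le> hausdorff_dist A B"
    by blast
  then show ?thesis
    using zero_le_dist[of a b] by linarith
qed (auto simp: hausdorff_dist_def)

lemma hausdorff_dist_commute: "hausdorff_dist A B = hausdorff_dist B A"
  unfolding hausdorff_dist_def by (simp add: max.commute dist_commute conj_ac)

lemma Metric_space_finite_subsets:
  "Metric_space (finite_subsets n :: 'a::metric_space set set) hausdorff_dist"
proof
  fix A B C :: "'a set"
  show "0 \<le> hausdorff_dist A B" by (rule hausdorff_dist_nonneg)
  show "hausdorff_dist A B = hausdorff_dist B A" by (rule hausdorff_dist_commute)
  assume A: "A \<in> finite_subsets n" and B: "B \<in> finite_subsets n"
  show "hausdorff_dist A B = 0 \<longleftrightarrow> A = B"
  proof -
    have "hausdorff_dist A B = 0 \<longleftrightarrow> hausdorff_dist A B \<le> 0"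
      using hausdorff_dist_nonneg[of A B] by linarith
    also have "\<dots> \<longleftrightarrow> A = B"
      using A B by (subst hausdorff_dist_le_iff) (auto simp: finite_subsets_def)
    finally show ?thesis .
  qed
  assume C: "C \<in> finite_subsets n"
  let ?p = "hausdorff_dist A B" and ?q = "hausdorff_dist B C"
  have 1: "\<forall>a\<in>A. \<exists>b\<in>B. dist a b \<le> ?p" "\<forall>b\<in>B. \<exists>a\<in>A. dist a b \<le> ?p"
    using A B hausdorff_dist_le_iff[of A B ?p] by (auto simp: finite_subsets_def)
  have 2: "\<forall>b\<in>B. \<exists>c\<in>C. dist b c \<le> ?q" "\<forall>c\<in>C. \<exists>b\<in>B. dist b c \<le> ?q"
    using B C hausdorff_dist_le_iff[of B C ?q] by (auto simp: finite_subsets_def)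
  have tri: "dist a c \<le> ?p + ?q" if "dist a b \<le> ?p" "dist b c \<le> ?q" for a b c :: 'a
    using that dist_triangle[of a c b] by linarith
  have "\<forall>a\<in>A. \<exists>c\<in>C. dist a c \<le> ?p + ?q" "\<forall>c\<in>C. \<exists>a\<in>A. dist a c \<le> ?p + ?q"
    using 1 2 tri by meson+
  then show "hausdorff_dist A C \<le> ?p + ?q"
    using A C by (subst hausdorff_dist_le_iff) (auto simp: finite_subsets_def)
qed

lemma mspace_finite_subset_space [simp]:
    "mspace (finite_subset_space n) = finite_subsets n"
  and mdist_finite_subset_space [simp]:
    "mdist (finite_subset_space n) = hausdorff_dist"
  unfolding finite_subset_space_def
  by (simp_all add: Metric_space.mspace_metric Metric_space.mdist_metric
        Metric_space_finite_subsets)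

definition Lipschitz_retraction :: "'a metric \<Rightarrow> 'a metric \<Rightarrow> ('a \<Rightarrow> 'a) \<Rightarrow> bool" where
  "Lipschitz_retraction X Y r \<longleftrightarrow>
     Lipschitz_continuous_map X Y r \<and> (\<forall>x \<in> mspace Y. r x = x)"

end

theory Submission
  imports Defs
begin

text \<open>To lose a point, a set of \<open>n\<close> points must merge two of them, and which two has to depend on
  the set in a Lipschitz way. Choosing a closest pair is discontinuous, so all points are made to
  attract one another at once. The energy \<open>F y = (\<Sum>i. \<Sum>j. norm (y i - y j))\<close> is convex, and
  for \<open>c \<ge> 0\<close> the function \<open>c * F y + (\<Sum>i. (norm (y i - x i))\<^sup>2) / 2\<close> of \<open>y\<close> has a minimizer \<open>z\<close>,
  the proximal point of \<open>F\<close> at the configuration \<open>x\<close> with parameter \<open>c\<close>. Strong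
  convexity and completeness give existence in any Hilbert space. One may picture \<open>z\<close> as one
  implicit Euler step of length \<open>c\<close> of the gradient flow of \<open>F\<close>. Two features of \<open>z\<close> matter.

  \<^item> It is a nonexpansive function of \<open>x\<close> in the \<open>l\<^sup>2\<close> norm, since the subdifferential of \<open>F\<close> is
    monotone, and a Lipschitz function of \<open>c\<close>, since \<open>F\<close> itself is Lipschitz
    (\<open>is_prox_Lipschitz\<close>). In particular \<open>z\<close> is within a multiple of \<open>c\<close> of \<open>x\<close>.
  \<^item> The unit kink of the norm at the origin makes nearby points coalesce: if
    \<open>norm (x i - x j) \<le> 2 * c\<close>, then \<open>z i = z j\<close> (\<open>is_prox_merges_pair\<close>).

  Let the gap of \<open>A\<close> be the least distance of two distinct points of \<open>A\<close> if \<open>A\<close> has \<open>n\<close> points, and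
  \<open>0\<close> if it has fewer. The retraction sends \<open>A\<close> to the set of values of the proximal point of the
  inclusion of \<open>A\<close>, with the gap of \<open>A\<close> as parameter. Sets with fewer than \<open>n\<close> points get
  parameter \<open>0\<close> and stay fixed; in a set with \<open>n\<close> points a closest pair merges.

  For the Lipschitz estimate let \<open>h\<close> be the Hausdorff distance of \<open>A\<close> and \<open>B\<close>. If the gap of \<open>A\<close>
  exceeds \<open>2 * h\<close>, then going to a nearby point is a bijection from \<open>A\<close> to \<open>B\<close>, along which both
  sets become configurations over the same index set at \<open>l\<^sup>2\<close> distance at most \<open>sqrt n * h\<close>, with
  gaps differing by at most \<open>2 * h\<close>; the first feature applies. The same holds with \<open>A\<close> and \<open>B\<close>
  exchanged. If both gaps are at most \<open>2 * h\<close>, both sets are moved by at most a multiple of \<open>h\<close>, and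
  the triangle inequality suffices.\<close>

section \<open>The pair energy\<close>

definition pair_energy :: "'i set \<Rightarrow> ('i \<Rightarrow> 'a::real_normed_vector) \<Rightarrow> real" where
  "pair_energy I y = (\<Sum>i\<in>I. \<Sum>j\<in>I. norm (y i - y j))"

lemma pair_energy_nonneg: "0 \<le> pair_energy I y"
  unfolding pair_energy_def by (intro sum_nonneg) auto

lemma pair_energy_cong:
  "(\<And>i. i \<in> I \<Longrightarrow> y i = z i) \<Longrightarrow> pair_energy I y = pair_energy I z"
  unfolding pair_energy_def by (intro sum.cong) auto

lemma pair_energy_reindex:
  assumes "bij_betw \<sigma> I J"
  shows "pair_energy I (\<lambda>i. y (\<sigma> i)) = pair_energy J y"
proof -
  have "(\<Sum>j\<in>I. norm (y (\<sigma> i) - y (\<sigma> j))) = (\<Sum>j\<in>J. norm (y (\<sigma> i) - y j))" for i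
    using sum.reindex_bij_betw[OF assms, of "\<lambda>j. norm (y (\<sigma> i) - y j)"] .
  then show ?thesis
    unfolding pair_energy_def
    using sum.reindex_bij_betw[OF assms, of "\<lambda>i. \<Sum>j\<in>J. norm (y i - y j)"] by simp
qed

lemma pair_energy_convex:
  assumes "0 \<le> t" "t \<le> 1"
  shows "pair_energy I (\<lambda>i. z i + t *\<^sub>R (w i - z i)) \<le> (1 - t) * pair_energy I z + t * pair_energy I w"
proof -
  have "norm ((z i + t *\<^sub>R (w i - z i)) - (z j + t *\<^sub>R (w j - z j)))
      \<le> (1 - t) * norm (z i - z j) + t * norm (w i - w j)" for i j
  proof -
    have "(z i + t *\<^sub>R (w i - z i)) - (z j + t *\<^sub>R (w j - z j))
        = (1 - t) *\<^sub>R (z i - z j) + t *\<^sub>R (w i - w j)"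
      by (simp add: algebra_simps)
    then show ?thesis
      using norm_triangle_ineq[of "(1 - t) *\<^sub>R (z i - z j)" "t *\<^sub>R (w i - w j)"] assms by simp
  qed
  then have "pair_energy I (\<lambda>i. z i + t *\<^sub>R (w i - z i))
      \<le> (\<Sum>i\<in>I. \<Sum>j\<in>I. (1 - t) * norm (z i - z j) + t * norm (w i - w j))"
    unfolding pair_energy_def by (intro sum_mono)
  also have "\<dots> = (1 - t) * pair_energy I z + t * pair_energy I w"
    unfolding pair_energy_def by (simp add: sum.distrib sum_distrib_left)
  finally show ?thesis .
qed

text \<open>A Lipschitz constant of the pair energy of \<open>n\<close> points for the \<open>l\<^sup>2\<close> norm. One factor \<open>n\<close>
  counts the partners of each point; \<open>sqrt n\<close> compares the \<open>l\<^sup>1\<close> with the \<open>l\<^sup>2\<close> norm.\<close>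

definition lip_const :: "nat \<Rightarrow> real" where
  "lip_const n = 2 * real n * sqrt (real n)"

lemma lip_const_nonneg: "0 \<le> lip_const n"
  by (simp add: lip_const_def)

lemma pair_energy_Lipschitz:
  "pair_energy I w - pair_energy I z \<le> lip_const (card I) * L2_set (\<lambda>i. norm (w i - z i)) I"
proof -
  let ?S = "\<Sum>i\<in>I. norm (w i - z i)"
  have "norm (w i - w j) \<le> norm (z i - z j) + (norm (w i - z i) + norm (w j - z j))" for i j
    using norm_triangle_ineq[of "z i - z j" "(w i - z i) - (w j - z j)"]
      norm_triangle_ineq4[of "w i - z i" "w j - z j"] by simp
  then have "pair_energy I w
      \<le> (\<Sum>i\<in>I. \<Sum>j\<in>I. norm (z i - z j) + (norm (w i - z i) + norm (w j - z j)))"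
    unfolding pair_energy_def by (intro sum_mono)
  also have "\<dots> = pair_energy I z + 2 * real (card I) * ?S"
    unfolding pair_energy_def by (simp add: sum.distrib sum_distrib_left[symmetric])
  finally have 1: "pair_energy I w - pair_energy I z \<le> 2 * real (card I) * ?S" by simp
  have "?S \<le> sqrt (real (card I)) * L2_set (\<lambda>i. norm (w i - z i)) I"
    using L2_set_mult_ineq[where f = "\<lambda>_. 1" and g = "\<lambda>i. norm (w i - z i)" and A = I]
    by (simp add: L2_set_def)
  then have "2 * real (card I) * ?S
      \<le> 2 * real (card I) * (sqrt (real (card I)) * L2_set (\<lambda>i. norm (w i - z i)) I)"
    by (intro mult_left_mono) auto
  with 1 show ?thesis by (simp add: lip_const_def mult.assoc)
qed

text \<open>Moving two points to their midpoint pays off at least at the rate at which they approach. The new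
  configuration is the average of \<open>z\<close> and of \<open>z\<close> with the two points swapped, two configurations
  of equal energy, so convexity shows that no interaction with a third point costs anything, while
  the term of the pair itself drops to \<open>0\<close>. (The drop is really twice the stated one, as both
  \<open>(i, j)\<close> and \<open>(j, i)\<close> occur in the energy.)\<close>

lemma pair_energy_midpoint_merge:
  fixes z :: "'i \<Rightarrow> 'a::real_normed_vector"
  assumes "finite I" "i \<in> I" "j \<in> I" "i \<noteq> j"
  defines "w \<equiv> z(i := (1/2) *\<^sub>R (z i + z j), j := (1/2) *\<^sub>R (z i + z j))"
  shows "pair_energy I w \<le> pair_energy I z - norm (z i - z j)"
proof -
  define \<tau> where "\<tau> = id(i := j, j := i)"
  have \<tau>: "bij_betw \<tau> I I"
    by (rule bij_betw_byWitness[where f' = \<tau>]) (use assms in \<open>auto simp: \<tau>_def\<close>)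
  have w: "w k = (1/2) *\<^sub>R (z k + z (\<tau> k))" for k
    using \<open>i \<noteq> j\<close> by (auto simp: w_def \<tau>_def add.commute scaleR_2[symmetric])
  \<comment> \<open>Averaging the two terms is exact bookkeeping except at the pair \<open>(i, j)\<close>, where the average is
    \<open>norm (z i - z j)\<close> and the left-hand side is \<open>0\<close>.\<close>
  have term_le: "norm (w k - w l) \<le> (norm (z k - z l) + norm (z (\<tau> k) - z (\<tau> l))) / 2
      - (if k = i then if l = j then norm (z i - z j) else 0 else 0)" for k l
  proof (cases "k = i \<and> l = j")
    case True
    then show ?thesis
      using \<open>i \<noteq> j\<close> by (simp add: w_def \<tau>_def norm_minus_commute[of "z j"])
  next
    case False
    have "w k - w l = (1/2) *\<^sub>R ((z k - z l) + (z (\<tau> k) - z (\<tau> l)))"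
      by (simp add: w algebra_simps)
    then have "norm (w k - w l) \<le> (norm (z k - z l) + norm (z (\<tau> k) - z (\<tau> l))) / 2"
      using norm_triangle_ineq[of "z k - z l" "z (\<tau> k) - z (\<tau> l)"] by simp
    then show ?thesis using False by auto
  qed
  have "pair_energy I w \<le> (\<Sum>k\<in>I. \<Sum>l\<in>I. (norm (z k - z l) + norm (z (\<tau> k) - z (\<tau> l))) / 2
      - (if k = i then if l = j then norm (z i - z j) else 0 else 0))"
    unfolding pair_energy_def by (intro sum_mono term_le)
  also have "\<dots> = (pair_energy I z + pair_energy I (\<lambda>k. z (\<tau> k))) / 2
      - (\<Sum>k\<in>I. \<Sum>l\<in>I. if k = i then if l = j then norm (z i - z j) else 0 else 0)"
    by (simp add: pair_energy_def sum_subtractf sum.distrib sum_divide_distrib add_divide_distrib)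
  also have "(\<Sum>k\<in>I. \<Sum>l\<in>I. if k = i then if l = j then norm (z i - z j) else 0 else 0)
      = (\<Sum>k\<in>I. if k = i then norm (z i - z j) else 0)"
    using assms by (intro sum.cong) auto
  also have "\<dots> = norm (z i - z j)" using assms by simp
  finally show ?thesis by (simp add: pair_energy_reindex[OF \<tau>])
qed

section \<open>Proximal points of the pair energy\<close>

text \<open>The condition says that \<open>x - z\<close> is a subgradient of \<open>c * F\<close> at \<open>z\<close>, where \<open>F\<close> is the pair energy. It
  characterizes the minimizer of \<open>c * F y + (\<Sum>i\<in>I. (norm (y i - x i))\<^sup>2) / 2\<close>, and all that follows
  comes from testing it with suitable \<open>w\<close>. It constrains \<open>z\<close> only on \<open>I\<close>.\<close>

definition is_prox :: "'i set \<Rightarrow> real \<Rightarrow> ('i \<Rightarrow> 'a::real_inner) \<Rightarrow> ('i \<Rightarrow> 'a) \<Rightarrow> bool" where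
  "is_prox I c x z \<longleftrightarrow>
     (\<forall>w. c * pair_energy I z + (\<Sum>i\<in>I. (x i - z i) \<bullet> (w i - z i)) \<le> c * pair_energy I w)"

text \<open>First-order optimality: moving from \<open>z\<close> a fraction \<open>t\<close> of the way to \<open>w\<close> changes the objective by at
  most \<open>t * (a + t * (q / 2))\<close>, with \<open>a\<close> the slack in the subgradient inequality. The change is
  nonnegative because \<open>z\<close> is a minimizer, and letting \<open>t\<close> tend to \<open>0\<close> gives \<open>0 \<le> a\<close>.\<close>

lemma is_prox_if_minimizer:
  fixes x z :: "'i \<Rightarrow> 'a::real_inner"
  assumes "0 \<le> c"
    and min: "\<And>w. c * pair_energy I z + (\<Sum>i\<in>I. (norm (z i - x i))\<^sup>2) / 2
                \<le> c * pair_energy I w + (\<Sum>i\<in>I. (norm (w i - x i))\<^sup>2) / 2"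
  shows "is_prox I c x z"
  unfolding is_prox_def
proof
  fix w
  define s where "s = (\<Sum>i\<in>I. (z i - x i) \<bullet> (w i - z i))"
  define q where "q = (\<Sum>i\<in>I. (norm (w i - z i))\<^sup>2)"
  define a where "a = c * (pair_energy I w - pair_energy I z) + s"
  have step: "0 \<le> a + t * (q / 2)" if t: "0 < t" "t \<le> 1" for t
  proof -
    have sq: "(norm (z i + t *\<^sub>R (w i - z i) - x i))\<^sup>2
        = (norm (z i - x i))\<^sup>2 + 2 * t * ((z i - x i) \<bullet> (w i - z i)) + t\<^sup>2 * (norm (w i - z i))\<^sup>2"
      for i
    proof -
      have "z i + t *\<^sub>R (w i - z i) - x i = (z i - x i) + t *\<^sub>R (w i - z i)" by simp
      then show ?thesis
        by (simp only: power2_norm_eq_inner)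
          (simp add: inner_add_left inner_add_right power2_eq_square inner_commute[of "w i - z i" "z i - x i"] distrib_left)
    qed
    have sum_sq: "(\<Sum>i\<in>I. (norm (z i + t *\<^sub>R (w i - z i) - x i))\<^sup>2)
        = (\<Sum>i\<in>I. (norm (z i - x i))\<^sup>2) + 2 * t * s + t\<^sup>2 * q"
      by (simp add: sq sum.distrib sum_distrib_left s_def q_def)
    have "c * pair_energy I (\<lambda>i. z i + t *\<^sub>R (w i - z i))
        \<le> c * ((1 - t) * pair_energy I z + t * pair_energy I w)"
      using pair_energy_convex[of t I z w] t \<open>0 \<le> c\<close> by (intro mult_left_mono) auto
    then have "0 \<le> t * (a + t * (q / 2))"
      using min[of "\<lambda>i. z i + t *\<^sub>R (w i - z i)", unfolded sum_sq]
      unfolding a_def power2_eq_square right_diff_distrib left_diff_distrib distrib_left distrib_right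
      by (simp add: field_simps)
    then show ?thesis using t by (simp add: zero_le_mult_iff)
  qed
  have "(\<lambda>k. a + inverse (real (Suc k)) * (q / 2)) \<longlonglongrightarrow> a + 0 * (q / 2)"
    by (intro tendsto_intros LIMSEQ_inverse_real_of_nat)
  moreover have "0 \<le> a + inverse (real (Suc k)) * (q / 2)" for k
    by (intro step) (auto simp: inverse_le_1_iff)
  ultimately have "0 \<le> a"
    using LIMSEQ_le_const by fastforce
  moreover have "(\<Sum>i\<in>I. (x i - z i) \<bullet> (w i - z i)) = - s"
    unfolding s_def by (simp add: inner_diff_left sum_negf[symmetric] algebra_simps)
  ultimately show "c * pair_energy I z + (\<Sum>i\<in>I. (x i - z i) \<bullet> (w i - z i)) \<le> c * pair_energy I w"
    by (simp add: a_def algebra_simps)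
qed

text \<open>No compactness is available in infinite dimension. Instead, the quadratic term makes every
  minimizing sequence Cauchy: by the parallelogram law, the midpoint of two almost minimizing
  configurations would beat the infimum if they were far apart.\<close>

lemma prox_exists:
  fixes x :: "'i \<Rightarrow> 'a::{real_inner, complete_space}"
  assumes "finite I" "0 \<le> c"
  shows "\<exists>z. is_prox I c x z"
proof -
  define Q where "Q y = c * pair_energy I y + (\<Sum>i\<in>I. (norm (y i - x i))\<^sup>2) / 2" for y
  define m where "m = Inf (range Q)"
  have Q0: "0 \<le> Q y" for y
    unfolding Q_def using \<open>0 \<le> c\<close>
    by (intro add_nonneg_nonneg mult_nonneg_nonneg pair_energy_nonneg divide_nonneg_nonneg sum_nonneg) auto
  have bdd: "bdd_below (range Q)" using Q0 by (auto simp: bdd_below_def)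
  have m_le: "m \<le> Q y" for y
    unfolding m_def by (rule cInf_lower[OF _ bdd]) simp
  have "\<exists>y. Q y < m + inverse (real (Suc k))" for k
    using cInf_lessD[of "range Q" "m + inverse (real (Suc k))"] unfolding m_def by auto
  then obtain Y where Y: "Q (Y k) < m + inverse (real (Suc k))" for k by metis
  have par: "(\<Sum>i\<in>I. (norm (u i - v i))\<^sup>2) \<le> 4 * ((Q u - m) + (Q v - m))" for u v
  proof -
    let ?w = "\<lambda>i. u i + (1/2) *\<^sub>R (v i - u i)"
    have sq: "(norm (?w i - x i))\<^sup>2
        = (norm (u i - x i))\<^sup>2 / 2 + (norm (v i - x i))\<^sup>2 / 2 - (norm (u i - v i))\<^sup>2 / 4" for i
    proof -
      define p where "p = u i - x i"
      define q where "q = v i - x i"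
      have "?w i - x i = (1/2) *\<^sub>R (p + q)" "u i - v i = p - q"
        by (simp_all add: p_def q_def algebra_simps scaleR_2[symmetric] flip: scaleR_left.add)
      then have "(norm (?w i - x i))\<^sup>2 = (norm p)\<^sup>2 / 2 + (norm q)\<^sup>2 / 2 - (norm (u i - v i))\<^sup>2 / 4"
        by (simp only: power2_norm_eq_inner)
          (simp add: inner_add_left inner_add_right inner_diff_left inner_diff_right inner_commute field_simps)
      then show ?thesis by (simp add: p_def q_def)
    qed
    have "(\<Sum>i\<in>I. (norm (?w i - x i))\<^sup>2) = (\<Sum>i\<in>I. (norm (u i - x i))\<^sup>2) / 2
        + (\<Sum>i\<in>I. (norm (v i - x i))\<^sup>2) / 2 - (\<Sum>i\<in>I. (norm (u i - v i))\<^sup>2) / 4"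
      by (simp add: sq sum.distrib sum_subtractf sum_divide_distrib)
    moreover have "c * pair_energy I ?w \<le> c * ((1 - 1/2) * pair_energy I u + 1/2 * pair_energy I v)"
      using pair_energy_convex[of "1/2" I u v] \<open>0 \<le> c\<close> by (intro mult_left_mono) auto
    ultimately show ?thesis
      using m_le[of ?w] unfolding Q_def by (simp add: algebra_simps)
  qed
  have "Cauchy (\<lambda>k. Y k i)" if "i \<in> I" for i
  proof (rule metric_CauchyI)
    fix e :: real assume "0 < e"
    then obtain N where N: "inverse (real (Suc N)) < e\<^sup>2 / 8"
      using reals_Archimedean[of "e\<^sup>2 / 8"] by auto
    have "dist (Y k i) (Y l i) < e" if "N \<le> k" "N \<le> l" for k l
    proof -
      have "(norm (Y k i - Y l i))\<^sup>2 \<le> (\<Sum>i\<in>I. (norm (Y k i - Y l i))\<^sup>2)"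
        using \<open>i \<in> I\<close> \<open>finite I\<close> by (intro member_le_sum) auto
      also have "\<dots> \<le> 4 * ((Q (Y k) - m) + (Q (Y l) - m))" by (rule par)
      also have "\<dots> < 4 * (inverse (real (Suc k)) + inverse (real (Suc l)))"
        using Y[of k] Y[of l] by simp
      also have "\<dots> \<le> 4 * (inverse (real (Suc N)) + inverse (real (Suc N)))"
        using that by (intro mult_left_mono add_mono le_imp_inverse_le) auto
      also have "\<dots> < e\<^sup>2" using N by simp
      finally show ?thesis
        using \<open>0 < e\<close> by (simp add: dist_norm power_less_imp_less_base)
    qed
    then show "\<exists>M. \<forall>k\<ge>M. \<forall>l\<ge>M. dist (Y k i) (Y l i) < e" by blast
  qed
  then have "\<forall>i. \<exists>l. i \<in> I \<longrightarrow> (\<lambda>k. Y k i) \<longlonglongrightarrow> l"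
    using Cauchy_convergent convergent_def by blast
  then obtain z where z: "(\<lambda>k. Y k i) \<longlonglongrightarrow> z i" if "i \<in> I" for i by metis
  have "(\<lambda>k. Q (Y k)) \<longlonglongrightarrow> Q z"
    unfolding Q_def pair_energy_def by (intro tendsto_intros z) auto
  moreover have "(\<lambda>k. m + inverse (real (Suc k))) \<longlonglongrightarrow> m + 0"
    by (intro tendsto_intros LIMSEQ_inverse_real_of_nat)
  ultimately have "Q z \<le> m + 0"
    by (rule LIMSEQ_le) (use Y less_imp_le in blast)
  then have "Q z \<le> Q w" for w using m_le[of w] by simp
  then have "is_prox I c x z"
    unfolding Q_def by (intro is_prox_if_minimizer \<open>0 \<le> c\<close>)
  then show ?thesis by blast
qed

text \<open>Testing the subgradient inequality of each point with the other one and adding up cancels the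
  energies when \<open>c = d\<close>, which leaves the monotonicity of the subdifferential and hence
  nonexpansiveness. For \<open>c \<noteq> d\<close> there remains \<open>c - d\<close> times a difference of energies, which is at
  most a multiple of the distance of \<open>z\<close> and \<open>w\<close>.\<close>

lemma is_prox_Lipschitz:
  fixes x y z w :: "'i \<Rightarrow> 'a::real_inner"
  assumes z: "is_prox I c x z" and w: "is_prox I d y w"
  shows "L2_set (\<lambda>i. norm (w i - z i)) I
           \<le> L2_set (\<lambda>i. norm (y i - x i)) I + lip_const (card I) * \<bar>c - d\<bar>"
proof -
  let ?N = "L2_set (\<lambda>i. norm (w i - z i)) I"
  let ?D = "L2_set (\<lambda>i. norm (y i - x i)) I"
  have N0: "0 \<le> ?N" by (rule L2_set_nonneg)
  have *: "\<bar>pair_energy I w - pair_energy I z\<bar> \<le> lip_const (card I) * ?N"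
    using pair_energy_Lipschitz[of I w z] pair_energy_Lipschitz[of I z w]
    by (simp add: abs_le_iff norm_minus_commute)
  have "(\<Sum>i\<in>I. (norm (w i - z i))\<^sup>2)
      = (\<Sum>i\<in>I. (x i - z i) \<bullet> (w i - z i)) + (\<Sum>i\<in>I. (y i - w i) \<bullet> (z i - w i))
        + (\<Sum>i\<in>I. (y i - x i) \<bullet> (w i - z i))"
    unfolding sum.distrib[symmetric]
    by (intro sum.cong) (auto simp: power2_norm_eq_inner algebra_simps inner_commute)
  also have "\<dots> \<le> (c - d) * (pair_energy I w - pair_energy I z)
        + (\<Sum>i\<in>I. (y i - x i) \<bullet> (w i - z i))"
    using z[unfolded is_prox_def, rule_format, of w] w[unfolded is_prox_def, rule_format, of z]
    by (simp add: algebra_simps)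
  also have "(c - d) * (pair_energy I w - pair_energy I z) \<le> \<bar>c - d\<bar> * (lip_const (card I) * ?N)"
    using mult_left_mono[OF *, of "\<bar>c - d\<bar>"] abs_ge_self[of "(c - d) * (pair_energy I w - pair_energy I z)"]
    by (simp add: abs_mult)
  also have "(\<Sum>i\<in>I. (y i - x i) \<bullet> (w i - z i)) \<le> (\<Sum>i\<in>I. norm (y i - x i) * norm (w i - z i))"
    by (intro sum_mono norm_cauchy_schwarz)
  also have "\<dots> \<le> ?D * ?N"
    using L2_set_mult_ineq[of "\<lambda>i. norm (y i - x i)" "\<lambda>i. norm (w i - z i)" I] by simp
  finally have "?N * ?N \<le> (?D + lip_const (card I) * \<bar>c - d\<bar>) * ?N"
    by (simp add: L2_set_def sum_nonneg algebra_simps)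
  moreover have "0 \<le> ?D + lip_const (card I) * \<bar>c - d\<bar>"
    by (simp add: L2_set_nonneg lip_const_nonneg)
  ultimately show ?thesis
    using N0 by (cases "?N = 0") (auto simp: mult_le_cancel_right)
qed

lemma is_prox_0: "is_prox I 0 x x"
  by (simp add: is_prox_def)

text \<open>This compares the parameters \<open>c\<close> and \<open>0\<close> at the same \<open>x\<close>: for \<open>0\<close> the proximal point is \<open>x\<close>.\<close>

lemma is_prox_displacement:
  assumes "is_prox I c x z" "finite I" "i \<in> I"
  shows "norm (x i - z i) \<le> lip_const (card I) * \<bar>c\<bar>"
  using is_prox_Lipschitz[OF assms(1) is_prox_0[of I x]]
    member_le_L2_set[of I i "\<lambda>i. norm (x i - z i)"] assms(2,3)
  by (simp add: L2_set_def)

text \<open>If \<open>z i\<close> and \<open>z j\<close> differed by \<open>d \<noteq> 0\<close>, putting both at their midpoint would lower the energy term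
  by \<open>c * norm d\<close> or more. The subgradient inequality allows it to drop by at most
  \<open>((x i - x j) \<bullet> d - (norm d)\<^sup>2) / 2 < c * norm d\<close>, a contradiction.\<close>

lemma is_prox_merges_pair:
  fixes x z :: "'i \<Rightarrow> 'a::real_inner"
  assumes z: "is_prox I c x z" and "finite I" "i \<in> I" "j \<in> I" "i \<noteq> j"
    and c: "norm (x i - x j) \<le> 2 * c"
  shows "z i = z j"
proof -
  define d where "d = z i - z j"
  define w where "w = z(i := (1/2) *\<^sub>R (z i + z j), j := (1/2) *\<^sub>R (z i + z j))"
  have wi: "w i - z i = - (1/2) *\<^sub>R d" and wj: "w j - z j = (1/2) *\<^sub>R d"
    using \<open>i \<noteq> j\<close>
    by (simp_all add: w_def d_def algebra_simps scaleR_2[symmetric] flip: scaleR_left.add)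
  have "(\<Sum>k\<in>I. (x k - z k) \<bullet> (w k - z k)) = (\<Sum>k\<in>{i,j}. (x k - z k) \<bullet> (w k - z k))"
    using assms by (intro sum.mono_neutral_right) (auto simp: w_def)
  also have "\<dots> = (norm d)\<^sup>2 / 2 - ((x i - x j) \<bullet> d) / 2"
    using \<open>i \<noteq> j\<close> unfolding power2_norm_eq_inner
    by (simp add: wi wj) (simp add: d_def inner_diff_left inner_diff_right inner_commute field_simps)
  finally have sum: "(\<Sum>k\<in>I. (x k - z k) \<bullet> (w k - z k)) = (norm d)\<^sup>2 / 2 - ((x i - x j) \<bullet> d) / 2" .
  have "0 \<le> c" using c norm_ge_zero[of "x i - x j"] by linarith
  then have "c * pair_energy I w \<le> c * (pair_energy I z - norm d)"
    unfolding w_def d_def using assms by (intro mult_left_mono pair_energy_midpoint_merge)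
  moreover have "c * pair_energy I z + (\<Sum>k\<in>I. (x k - z k) \<bullet> (w k - z k)) \<le> c * pair_energy I w"
    using z by (simp add: is_prox_def)
  moreover have "(x i - x j) \<bullet> d \<le> 2 * c * norm d"
    using norm_cauchy_schwarz[of "x i - x j" d] mult_right_mono[OF c, of "norm d"] by simp
  ultimately have "(norm d)\<^sup>2 \<le> 0"
    unfolding sum right_diff_distrib by linarith
  then show ?thesis by (simp add: d_def)
qed

text \<open>Proximal points do not depend on the names of the points. This allows the proximal points of two
  different sets, each indexed by itself, to be compared along a bijection.\<close>

lemma is_prox_reindex:
  fixes x z :: "'j \<Rightarrow> 'a::real_inner"
  assumes \<sigma>: "bij_betw \<sigma> (I :: 'i set) J" and z: "is_prox J c x z"
  shows "is_prox I c (\<lambda>i. x (\<sigma> i)) (\<lambda>i. z (\<sigma> i))"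
  unfolding is_prox_def
proof
  fix w :: "'i \<Rightarrow> 'a"
  define v where "v = (\<lambda>j. w (inv_into I \<sigma> j))"
  have v: "v (\<sigma> i) = w i" if "i \<in> I" for i
    using that \<sigma> by (simp add: v_def bij_betw_inv_into_left)
  have "(\<Sum>i\<in>I. (x (\<sigma> i) - z (\<sigma> i)) \<bullet> (w i - z (\<sigma> i)))
      = (\<Sum>i\<in>I. (x (\<sigma> i) - z (\<sigma> i)) \<bullet> (v (\<sigma> i) - z (\<sigma> i)))"
    by (intro sum.cong) (auto simp: v)
  also have "\<dots> = (\<Sum>j\<in>J. (x j - z j) \<bullet> (v j - z j))"
    by (rule sum.reindex_bij_betw[OF \<sigma>])
  moreover have "pair_energy I w = pair_energy J v"
    using pair_energy_cong[of I w "\<lambda>i. v (\<sigma> i)"] v pair_energy_reindex[OF \<sigma>, of v] by simp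
  ultimately show "c * pair_energy I (\<lambda>i. z (\<sigma> i))
      + (\<Sum>i\<in>I. (x (\<sigma> i) - z (\<sigma> i)) \<bullet> (w i - z (\<sigma> i))) \<le> c * pair_energy I w"
    using z by (simp add: is_prox_def pair_energy_reindex[OF \<sigma>])
qed

section \<open>The gap of a finite set\<close>

text \<open>The value \<open>0\<close> for sets with fewer than \<open>n\<close> points keeps them fixed by the retraction, and it is the
  limit of the gaps of \<open>n\<close>-point sets that approach such a set.\<close>

definition gap :: "nat \<Rightarrow> 'a::metric_space set \<Rightarrow> real" where
  "gap n A = (if card A = n then Min ((\<lambda>(a, b). dist a b) ` {(a, b). a \<in> A \<and> b \<in> A \<and> a \<noteq> b}) else 0)"

lemma finite_distinct_pairs: "finite A \<Longrightarrow> finite {(a, b). a \<in> A \<and> b \<in> A \<and> a \<noteq> b}"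
  by (rule finite_subset[of _ "A \<times> A"]) auto

lemma gap_le:
  assumes "finite A" "a \<in> A" "b \<in> A" "a \<noteq> b"
  shows "gap n A \<le> dist a b"
  unfolding gap_def using assms finite_distinct_pairs[of A] by (auto intro!: Min_le)

lemma gap_attained:
  assumes "finite A" "card A = n" "n \<ge> 2"
  obtains a b where "a \<in> A" "b \<in> A" "a \<noteq> b" "dist a b = gap n A"
proof -
  let ?P = "{(a, b). a \<in> A \<and> b \<in> A \<and> a \<noteq> b}"
  have "\<not> card A \<le> Suc 0" using assms by simp
  then obtain p q where "p \<in> A" "q \<in> A" "p \<noteq> q"
    using card_le_Suc0_iff_eq[OF \<open>finite A\<close>] by blast
  then have "?P \<noteq> {}" by blast
  then have "Min ((\<lambda>(a, b). dist a b) ` ?P) \<in> (\<lambda>(a, b). dist a b) ` ?P"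
    using finite_distinct_pairs[OF \<open>finite A\<close>] by (intro Min_in) auto
  then show thesis using that assms by (auto simp: gap_def)
qed

lemma gap_nonneg:
  assumes "finite A" "n \<ge> 2"
  shows "0 \<le> gap n A"
proof (cases "card A = n")
  case True
  obtain a b where "a \<in> A" "b \<in> A" "a \<noteq> b" "dist a b = gap n A"
    by (rule gap_attained[OF assms(1) True assms(2)])
  then show ?thesis using zero_le_dist[of a b] by simp
qed (simp add: gap_def)

lemma gap_le_gap_add:
  assumes "finite A" "card A = n" "n \<ge> 2" "finite B" "inj_on f A" "f ` A \<subseteq> B"
    and "\<And>a. a \<in> A \<Longrightarrow> dist a (f a) \<le> h"
  shows "gap n B \<le> gap n A + 2 * h"
proof -
  obtain a b where ab: "a \<in> A" "b \<in> A" "a \<noteq> b" "dist a b = gap n A"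
    by (rule gap_attained[OF assms(1-3)])
  have "f a \<in> B" "f b \<in> B" "f a \<noteq> f b"
    using ab assms(5,6) by (auto simp: inj_on_def)
  then have "gap n B \<le> dist (f a) (f b)"
    by (rule gap_le[OF \<open>finite B\<close>])
  also have "\<dots> \<le> dist a b + 2 * h"
    using dist_triangle[of "f a" "f b" a] dist_triangle[of a "f b" b] assms(7)[OF ab(1)] assms(7)[OF ab(2)]
    by (simp add: dist_commute)
  finally show ?thesis using ab by simp
qed

text \<open>Distinct points of \<open>A\<close> are more than \<open>2 * h\<close> apart, so they cannot share a point of \<open>B\<close> within
  distance \<open>h\<close>. Hence \<open>A\<close> injects into \<open>B\<close>, and \<open>card B \<le> n = card A\<close> makes this a bijection. The
  gap of \<open>A\<close> alone is thus enough to control both sets.\<close>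

lemma matching_if_gap_large:
  fixes A B :: "'a::metric_space set"
  assumes A: "A \<in> finite_subsets n" and B: "B \<in> finite_subsets n" and "n \<ge> 2"
    and h: "hausdorff_dist A B \<le> h" and large: "2 * h < gap n A"
  obtains \<sigma> where "bij_betw \<sigma> A B" "card A = n" "card B = n"
    "\<And>a. a \<in> A \<Longrightarrow> dist a (\<sigma> a) \<le> h" "\<bar>gap n A - gap n B\<bar> \<le> 2 * h"
proof -
  have fin: "finite A" "finite B" and ne: "A \<noteq> {}" "B \<noteq> {}" and le: "card B \<le> n"
    using A B by (auto simp: finite_subsets_def)
  have h0: "0 \<le> h" using h hausdorff_dist_nonneg[of A B] by linarith
  \<comment> \<open>A smaller set would have gap \<open>0\<close>.\<close>
  with large have cardA: "card A = n" by (auto simp: gap_def split: if_splits)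
  have "\<forall>a\<in>A. \<exists>b\<in>B. dist a b \<le> h"
    using h hausdorff_dist_le_iff[OF fin(1) ne(1) fin(2) ne(2)] by simp
  then obtain \<sigma> where \<sigma>: "\<And>a. a \<in> A \<Longrightarrow> \<sigma> a \<in> B \<and> dist a (\<sigma> a) \<le> h"
    by metis
  have inj: "inj_on \<sigma> A"
  proof (rule inj_onI, rule ccontr)
    fix a b assume ab: "a \<in> A" "b \<in> A" "\<sigma> a = \<sigma> b" "a \<noteq> b"
    have "dist a b \<le> 2 * h"
      using dist_triangle[of a b "\<sigma> a"] \<sigma>[OF ab(1)] \<sigma>[OF ab(2)] ab(3) by (simp add: dist_commute)
    then show False using gap_le[OF fin(1) ab(1,2,4), of n] large by simp
  qed
  have sub: "\<sigma> ` A \<subseteq> B" using \<sigma> by auto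
  have cardB: "card B = n"
    using card_inj_on_le[OF inj sub fin(2)] cardA le by simp
  have img: "\<sigma> ` A = B"
    using card_subset_eq[OF fin(2) sub] card_image[OF inj] cardA cardB by simp
  have bij: "bij_betw \<sigma> A B" using inj img by (simp add: bij_betw_def)
  have "gap n B \<le> gap n A + 2 * h"
    using gap_le_gap_add[OF fin(1) cardA \<open>n \<ge> 2\<close> fin(2) inj sub] \<sigma> by blast
  moreover have "gap n A \<le> gap n B + 2 * h"
  proof (rule gap_le_gap_add[OF fin(2) cardB \<open>n \<ge> 2\<close> fin(1)])
    show "inj_on (inv_into A \<sigma>) B" "inv_into A \<sigma> ` B \<subseteq> A"
      using bij_betw_inv_into[OF bij] by (auto simp: bij_betw_def)
    show "dist b (inv_into A \<sigma> b) \<le> h" if "b \<in> B" for b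
      using \<sigma>[of "inv_into A \<sigma> b"] inv_into_into[of b \<sigma> A] bij_betw_inv_into_right[OF bij that] that img
      by (simp add: dist_commute)
  qed
  ultimately show thesis by (intro that[OF bij cardA cardB]) (use \<sigma> in auto)
qed

section \<open>The retraction\<close>

text \<open>A proximal point is determined only on the index set \<open>A\<close>, so as a total function it has to be
  chosen. On \<open>A\<close> it is unique, hence its image of \<open>A\<close> is canonical.\<close>

definition prox_map :: "nat \<Rightarrow> 'a::real_inner set \<Rightarrow> 'a \<Rightarrow> 'a" where
  "prox_map n A = (SOME z. is_prox A (gap n A) (\<lambda>a. a) z)"

definition coalesce :: "nat \<Rightarrow> 'a::real_inner set \<Rightarrow> 'a set" where
  "coalesce n A = prox_map n A ` A"

lemma is_prox_prox_map:
  fixes A :: "'a::{real_inner, complete_space} set"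
  assumes "finite A" "n \<ge> 2"
  shows "is_prox A (gap n A) (\<lambda>a. a) (prox_map n A)"
  unfolding prox_map_def
  by (rule someI_ex[OF prox_exists]) (use assms gap_nonneg in auto)

text \<open>The constant for \<open>card A\<close> may be replaced by the one for \<open>n\<close> because a set with fewer than \<open>n\<close> points
  has gap \<open>0\<close> and does not move.\<close>

lemma prox_map_displacement:
  fixes A :: "'a::{real_inner, complete_space} set"
  assumes "A \<in> finite_subsets n" "n \<ge> 2" "a \<in> A"
  shows "dist a (prox_map n A a) \<le> lip_const n * gap n A"
proof -
  have "finite A" "card A \<le> n" using assms by (auto simp: finite_subsets_def)
  have "dist a (prox_map n A a) \<le> lip_const (card A) * gap n A"
    using is_prox_displacement[OF is_prox_prox_map[OF \<open>finite A\<close> \<open>n \<ge> 2\<close>] \<open>finite A\<close> \<open>a \<in> A\<close>]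
      gap_nonneg[OF \<open>finite A\<close> \<open>n \<ge> 2\<close>] by (simp add: dist_norm)
  then show ?thesis by (cases "card A = n") (auto simp: gap_def)
qed

lemma coalesce_eq_self:
  fixes A :: "'a::{real_inner, complete_space} set"
  assumes "A \<in> finite_subsets (n - 1)" "n \<ge> 2"
  shows "coalesce n A = A"
proof -
  have A: "A \<in> finite_subsets n" and "card A < n"
    using assms by (auto simp: finite_subsets_def)
  then have "gap n A = 0" by (simp add: gap_def)
  then have "prox_map n A a = a" if "a \<in> A" for a
    using prox_map_displacement[OF A \<open>n \<ge> 2\<close> that] by simp
  then show ?thesis by (simp add: coalesce_def)
qed

text \<open>In a set with \<open>n\<close> points a closest pair has distance equal to the gap, hence at most twice the
  parameter, and merges.\<close>

lemma coalesce_in_finite_subsets: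
  fixes A :: "'a::{real_inner, complete_space} set"
  assumes A: "A \<in> finite_subsets n" and "n \<ge> 2"
  shows "coalesce n A \<in> finite_subsets (n - 1)"
proof (cases "card A = n")
  case False
  then have less: "A \<in> finite_subsets (n - 1)" using A by (auto simp: finite_subsets_def)
  then show ?thesis using coalesce_eq_self[OF less \<open>n \<ge> 2\<close>] by simp
next
  case True
  have fin: "finite A" and ne: "A \<noteq> {}" using A by (auto simp: finite_subsets_def)
  obtain a b where ab: "a \<in> A" "b \<in> A" "a \<noteq> b" "dist a b = gap n A"
    by (rule gap_attained[OF fin True \<open>n \<ge> 2\<close>])
  have "prox_map n A a = prox_map n A b"
    by (rule is_prox_merges_pair[OF is_prox_prox_map[OF fin \<open>n \<ge> 2\<close>] fin ab(1-3)])
      (use ab gap_nonneg[OF fin \<open>n \<ge> 2\<close>] in \<open>simp add: dist_norm\<close>)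
  then have "\<not> inj_on (prox_map n A) A" using ab by (auto simp: inj_on_def)
  then have "card (coalesce n A) < n"
    unfolding coalesce_def using card_image_le[OF fin, of "prox_map n A"] eq_card_imp_inj_on[OF fin, of "prox_map n A"] True
    by linarith
  then show ?thesis using fin ne by (auto simp: finite_subsets_def coalesce_def)
qed

lemma hausdorff_dist_image_le:
  assumes "finite A" "A \<noteq> {}" "\<And>a. a \<in> A \<Longrightarrow> dist (f a) (g a) \<le> e"
  shows "hausdorff_dist (f ` A) (g ` A) \<le> e"
  using assms by (subst hausdorff_dist_le_iff) auto

text \<open>The matching \<open>\<sigma>\<close> turns both proximal points into families over \<open>A\<close>. Nearby families have images that
  are close in the Hausdorff distance.\<close>

lemma coalesce_Lipschitz_if_gap_large:
  fixes A B :: "'a::{real_inner, complete_space} set"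
  assumes A: "A \<in> finite_subsets n" and B: "B \<in> finite_subsets n" and "n \<ge> 2"
    and large: "2 * hausdorff_dist A B < gap n A"
  shows "hausdorff_dist (coalesce n A) (coalesce n B) \<le> (sqrt n + 2 * lip_const n) * hausdorff_dist A B"
proof -
  define h where "h = hausdorff_dist A B"
  obtain \<sigma> where bij: "bij_betw \<sigma> A B" and cards: "card A = n" "card B = n"
    and \<sigma>: "\<And>a. a \<in> A \<Longrightarrow> dist a (\<sigma> a) \<le> h" and gaps: "\<bar>gap n A - gap n B\<bar> \<le> 2 * h"
    by (rule matching_if_gap_large[OF A B \<open>n \<ge> 2\<close>, of h]) (use large in \<open>auto simp: h_def\<close>)
  have fin: "finite A" "finite B" and ne: "A \<noteq> {}"
    using A B by (auto simp: finite_subsets_def)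
  have h0: "0 \<le> h" by (simp add: h_def hausdorff_dist_nonneg)
  let ?z = "prox_map n A" and ?w = "\<lambda>a. prox_map n B (\<sigma> a)"
  have "L2_set (\<lambda>a. norm (\<sigma> a - a)) A \<le> L2_set (\<lambda>_. h) A"
    using \<sigma> by (intro L2_set_mono) (auto simp: dist_norm norm_minus_commute)
  also have "\<dots> = sqrt n * h"
    using h0 cards by (simp add: L2_set_def real_sqrt_mult)
  finally have D: "L2_set (\<lambda>a. norm (\<sigma> a - a)) A \<le> sqrt n * h" .
  have "L2_set (\<lambda>a. norm (?w a - ?z a)) A
      \<le> L2_set (\<lambda>a. norm (\<sigma> a - a)) A + lip_const (card A) * \<bar>gap n A - gap n B\<bar>"
    by (rule is_prox_Lipschitz[OF is_prox_prox_map[OF fin(1) \<open>n \<ge> 2\<close>]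
          is_prox_reindex[OF bij is_prox_prox_map[OF fin(2) \<open>n \<ge> 2\<close>]]])
  also have "\<dots> \<le> sqrt n * h + lip_const n * (2 * h)"
    using D mult_left_mono[OF gaps lip_const_nonneg[of n]] cards by simp
  finally have N: "L2_set (\<lambda>a. norm (?w a - ?z a)) A \<le> (sqrt n + 2 * lip_const n) * h"
    by (simp add: algebra_simps)
  have "dist (?z a) (?w a) \<le> (sqrt n + 2 * lip_const n) * h" if "a \<in> A" for a
    using member_le_L2_set[OF fin(1) that, of "\<lambda>a. norm (?w a - ?z a)"] N
    by (simp add: dist_norm norm_minus_commute)
  then have "hausdorff_dist (?z ` A) (?w ` A) \<le> (sqrt n + 2 * lip_const n) * h"
    using fin(1) ne by (intro hausdorff_dist_image_le)
  moreover have "?w ` A = coalesce n B"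
    using bij by (auto simp: coalesce_def bij_betw_def image_image[symmetric])
  ultimately show ?thesis by (simp add: coalesce_def h_def)
qed

lemma hausdorff_dist_coalesce_le:
  fixes A :: "'a::{real_inner, complete_space} set"
  assumes "A \<in> finite_subsets n" "n \<ge> 2"
  shows "hausdorff_dist A (coalesce n A) \<le> lip_const n * gap n A"
  using hausdorff_dist_image_le[of A "\<lambda>a. a" "prox_map n A" "lip_const n * gap n A"]
    prox_map_displacement[OF assms] assms(1)
  by (auto simp: coalesce_def finite_subsets_def)

text \<open>Here no matching need exist, but each set moves by at most a multiple of its gap.\<close>

lemma coalesce_Lipschitz_if_gaps_small:
  fixes A B :: "'a::{real_inner, complete_space} set"
  assumes A: "A \<in> finite_subsets n" and B: "B \<in> finite_subsets n" and "n \<ge> 2"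
    and small: "gap n A \<le> 2 * hausdorff_dist A B" "gap n B \<le> 2 * hausdorff_dist A B"
  shows "hausdorff_dist (coalesce n A) (coalesce n B) \<le> (1 + 4 * lip_const n) * hausdorff_dist A B"
proof -
  interpret Metric_space "finite_subsets n :: 'a set set" hausdorff_dist
    by (rule Metric_space_finite_subsets)
  have mA: "coalesce n A \<in> finite_subsets n" and mB: "coalesce n B \<in> finite_subsets n"
    using coalesce_in_finite_subsets[OF A \<open>n \<ge> 2\<close>] coalesce_in_finite_subsets[OF B \<open>n \<ge> 2\<close>]
    by (auto simp: finite_subsets_def)
  have "hausdorff_dist (coalesce n A) (coalesce n B)
      \<le> hausdorff_dist A (coalesce n A) + (hausdorff_dist A B + hausdorff_dist B (coalesce n B))"
    using triangle[OF mA A mB] triangle[OF A B mB] by (simp add: commute)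
  also have "\<dots> \<le> lip_const n * (2 * hausdorff_dist A B)
      + (hausdorff_dist A B + lip_const n * (2 * hausdorff_dist A B))"
    using hausdorff_dist_coalesce_le[OF A \<open>n \<ge> 2\<close>] hausdorff_dist_coalesce_le[OF B \<open>n \<ge> 2\<close>]
      mult_left_mono[OF small(1) lip_const_nonneg[of n]] mult_left_mono[OF small(2) lip_const_nonneg[of n]]
    by linarith
  finally show ?thesis by (simp add: algebra_simps)
qed

lemma coalesce_Lipschitz:
  fixes A B :: "'a::{real_inner, complete_space} set"
  assumes A: "A \<in> finite_subsets n" and B: "B \<in> finite_subsets n" and "n \<ge> 2"
  shows "hausdorff_dist (coalesce n A) (coalesce n B)
           \<le> (1 + sqrt n + 4 * lip_const n) * hausdorff_dist A B"
proof -
  have *: "L * hausdorff_dist A B \<le> (1 + sqrt n + 4 * lip_const n) * hausdorff_dist A B"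
    if "L \<le> 1 + sqrt n + 4 * lip_const n" for L
    using that by (intro mult_right_mono hausdorff_dist_nonneg)
  consider "2 * hausdorff_dist A B < gap n A" | "2 * hausdorff_dist B A < gap n B"
    | "gap n A \<le> 2 * hausdorff_dist A B" "gap n B \<le> 2 * hausdorff_dist A B"
    using hausdorff_dist_commute[of A B] by (metis linorder_not_le)
  then show ?thesis
  proof cases
    case 1
    then show ?thesis
      using coalesce_Lipschitz_if_gap_large[OF A B \<open>n \<ge> 2\<close>] *[of "sqrt n + 2 * lip_const n"]
        lip_const_nonneg[of n] by simp
  next
    case 2
    then show ?thesis
      using coalesce_Lipschitz_if_gap_large[OF B A \<open>n \<ge> 2\<close>] *[of "sqrt n + 2 * lip_const n"]
        lip_const_nonneg[of n] by (simp add: hausdorff_dist_commute)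
  next
    case 3
    then show ?thesis
      using coalesce_Lipschitz_if_gaps_small[OF A B \<open>n \<ge> 2\<close>] *[of "1 + 4 * lip_const n"] by simp
  qed
qed

theorem theorem1p1:
  fixes n :: nat
  assumes "n \<ge> 2"
  shows "\<exists>r :: 'a::{real_inner, complete_space} set \<Rightarrow> 'a set.
           Lipschitz_retraction (finite_subset_space n) (finite_subset_space (n - 1)) r"
proof
  show "Lipschitz_retraction (finite_subset_space n) (finite_subset_space (n - 1))
          (coalesce n :: 'a set \<Rightarrow> 'a set)"
    unfolding Lipschitz_retraction_def Lipschitz_continuous_map_def
      mspace_finite_subset_space mdist_finite_subset_space
    using coalesce_in_finite_subsets[OF _ assms] coalesce_Lipschitz[OF _ _ assms]
      coalesce_eq_self[OF _ assms] by blast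
qed

end
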